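(* Suppose that $\Gamma$ is a cli Polish group, $X$ is an analytic metric space, $\Gamma \curvearrowright X$ is a continuous action, $(\Delta_i)_{i \in \mathbb{N}}$ is a neighborhood basis of the identity $1_\Gamma$ consisting of symmetric open sets, $G_{i,j} = R_{\Delta_i}^X \setminus R_{\Delta_j}^X$ for all $i,j \in \mathbb{N}$, and there are Borel sets $B_n \subseteq X$ with the property that $X = \bigcup_{n \in \mathbb{N}} B_n$ and $\forall n \in \mathbb{N}\ \exists i \in \mathbb{N}\ \forall j \in \mathbb{N}\ \chi_B(G_{i,j} \restriction B_n) \le \aleph_0$. Then the action $\Gamma \curvearrowright X$ is $\sigma$-lacunary.
   Context: A subset of a Hausdorff space is analytic if it is empty or a continuous image of $\mathbb{N}^{\mathbb{N}}$; an analytic metric space is a metric space that is analytic as a topological space. A topological group is cli if it has a compatible complete left-invariant metric (equivalently, a compatible complete right-invariant metric). A set $\Delta \subseteq \Gamma$ is symmetric if $\Delta^{-1} = \Delta$. An action is continuous if the map $\Gamma \times X \to X$, $(\gamma,x) \mapsto \gamma \cdot x$, is continuous. The orbit equivalence relation is $x \mathrel{E_\Gamma^X} y \iff \exists \gamma \in \Gamma\ \gamma \cdot x = y$. For $\Delta \subseteq \Gamma$, the orbit relation is $x \mathrel{R_\Delta^X} y \iff \exists \delta \in \Delta\ \delta \cdot x = y$. A set $Y \subseteq X$ is $\Delta$-lacunary if $y \mathrel{R_\Delta^X} z \implies y = z$ for all $y, z \in Y$. For an equivalence relation $E$ on $X$, a set $Y \subseteq X$ is $E$-complete if it meets every $E$-class.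 A Borel action $\Gamma \curvearrowright X$ is $\sigma$-lacunary if there are $E_\Gamma^X$-invariant Borel sets $X_n \subseteq X$ with $X = \bigcup_{n \in \mathbb{N}} X_n$, open neighborhoods $\Delta'_n \subseteq \Gamma$ of $1_\Gamma$, and $\Delta'_n$-lacunary $E_\Gamma^{X_n}$-complete Borel sets $B'_n \subseteq X_n$, for all $n \in \mathbb{N}$. A graph on $X$ is an irreflexive symmetric subset of $X \times X$; $G \restriction B = G \cap (B \times B)$, viewed as a graph on $B$. For a graph $G$ on $B$, $\chi_B(G) \le \aleph_0$ means that there is a Borel map $c \colon B \to \mathbb{N}$ such that $c(x) \ne c(y)$ whenever $(x,y) \in G$. *)

theory Defs
  imports "HOL-Analysis.Analysis"
begin

text \<open>
  Topological groups are types of class \<^class>\<open>topological_group_add\<close>, which is not assumed to be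
  commutative. So the group operation is written additively: the identity is \<open>0\<close>, the product
  \<open>\<gamma>\<delta>\<close> is \<open>\<gamma> + \<delta>\<close>, and the inverse of \<open>\<gamma>\<close> is \<open>- \<gamma>\<close>.
\<close>

text \<open>
  The metric \<open>d\<close> is quantified separately. It has nothing to do with the metric \<open>dist\<close> that
  the type \<open>'g\<close> may carry through the class \<^class>\<open>polish_space\<close>, which need not be invariant.
\<close>
definition cli :: "'g::topological_group_add itself \<Rightarrow> bool" where
  "cli _ \<longleftrightarrow> (\<exists>d :: 'g \<Rightarrow> 'g \<Rightarrow> real.
     Metric_space UNIV d \<and>
     Metric_space.mtopology UNIV d = euclidean \<and>
     Metric_space.mcomplete UNIV d \<and>
     (\<forall>g x y. d (g + x) (g + y) = d x y))"

text \<open>\<open>nat \<Rightarrow> nat\<close> carries the product topology of discrete spaces, i.e. it is Baire space.\<close>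
definition analytic_set :: "'a::t2_space set \<Rightarrow> bool" where
  "analytic_set A \<longleftrightarrow>
     A = {} \<or> (\<exists>f :: (nat \<Rightarrow> nat) \<Rightarrow> 'a. continuous_on UNIV f \<and> range f = A)"

definition is_action :: "('g::group_add \<Rightarrow> 'x \<Rightarrow> 'x) \<Rightarrow> bool" where
  "is_action act \<longleftrightarrow>
     (\<forall>x. act 0 x = x) \<and> (\<forall>g h x. act (g + h) x = act g (act h x))"

definition continuous_action ::
    "('g::topological_group_add \<Rightarrow> 'x::topological_space \<Rightarrow> 'x) \<Rightarrow> bool" where
  "continuous_action act \<longleftrightarrow>
     is_action act \<and> continuous_on UNIV (\<lambda>(g, x). act g x)"

definition symmetric_set :: "'g::group_add set \<Rightarrow> bool" where
  "symmetric_set D \<longleftrightarrow> uminus ` D = D"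

definition open_nhds_basis_0 :: "(nat \<Rightarrow> 'g::topological_group_add set) \<Rightarrow> bool" where
  "open_nhds_basis_0 \<Delta> \<longleftrightarrow>
     (\<forall>i. open (\<Delta> i) \<and> 0 \<in> \<Delta> i) \<and>
     (\<forall>U. open U \<and> 0 \<in> U \<longrightarrow> (\<exists>i. \<Delta> i \<subseteq> U))"

text \<open>
  \<open>orbit_rel act D X\<close> is the relation \<open>R\<^sub>D\<^sup>X\<close> on \<open>X\<close>;
  for \<open>D = UNIV\<close> it is the orbit equivalence relation on \<open>X\<close>.
\<close>
definition orbit_rel :: "('g \<Rightarrow> 'x \<Rightarrow> 'x) \<Rightarrow> 'g set \<Rightarrow> 'x set \<Rightarrow> ('x \<times> 'x) set" where
  "orbit_rel act D X = {(x, y). x \<in> X \<and> y \<in> X \<and> (\<exists>g\<in>D. act g x = y)}"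

definition lacunary :: "('g \<Rightarrow> 'x \<Rightarrow> 'x) \<Rightarrow> 'g set \<Rightarrow> 'x set \<Rightarrow> bool" where
  "lacunary act D Y \<longleftrightarrow> (\<forall>y\<in>Y. \<forall>z\<in>Y. (y, z) \<in> orbit_rel act D UNIV \<longrightarrow> y = z)"

definition invariant_set :: "('x \<times> 'x) set \<Rightarrow> 'x set \<Rightarrow> bool" where
  "invariant_set E Y \<longleftrightarrow> E `` Y \<subseteq> Y"

definition complete_for :: "'x set \<Rightarrow> ('x \<times> 'x) set \<Rightarrow> 'x set \<Rightarrow> bool" where
  "complete_for X E Y \<longleftrightarrow> (\<forall>C \<in> X // E. Y \<inter> C \<noteq> {})"

definition sigma_lacunary ::
    "('g::topological_group_add \<Rightarrow> 'x::topological_space \<Rightarrow> 'x) \<Rightarrow> bool" where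
  "sigma_lacunary act \<longleftrightarrow>
     (\<exists>(X :: nat \<Rightarrow> 'x set) (\<Delta>' :: nat \<Rightarrow> 'g set) (B' :: nat \<Rightarrow> 'x set).
        (\<Union>n. X n) = UNIV \<and>
        (\<forall>n. X n \<in> sets borel \<and> invariant_set (orbit_rel act UNIV UNIV) (X n) \<and>
             open (\<Delta>' n) \<and> 0 \<in> \<Delta>' n \<and>
             B' n \<in> sets borel \<and> B' n \<subseteq> X n \<and>
             lacunary act (\<Delta>' n) (B' n) \<and>
             complete_for (X n) (orbit_rel act UNIV (X n)) (B' n)))"

definition countable_borel_chromatic :: "'x::topological_space set \<Rightarrow> ('x \<times> 'x) set \<Rightarrow> bool" where
  "countable_borel_chromatic B G \<longleftrightarrow>
     (\<exists>c :: 'x \<Rightarrow> nat. c \<in> borel_measurable (restrict_space borel B) \<and>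
        (\<forall>(x, y)\<in>G. c x \<noteq> c y))"

definition orbit_graph ::
    "('g \<Rightarrow> 'x \<Rightarrow> 'x) \<Rightarrow> (nat \<Rightarrow> 'g set) \<Rightarrow> nat \<Rightarrow> nat \<Rightarrow> ('x \<times> 'x) set" where
  "orbit_graph act \<Delta> i j = orbit_rel act (\<Delta> i) UNIV - orbit_rel act (\<Delta> j) UNIV"

lemma orbit_rel_sym:
  assumes "is_action act" and "symmetric_set D"
  shows "sym (orbit_rel act D X)"
proof (rule symI)
  fix x y assume "(x, y) \<in> orbit_rel act D X"
  then obtain g where g: "x \<in> X" "y \<in> X" "g \<in> D" "act g x = y"
    by (auto simp: orbit_rel_def)
  have "- g \<in> D" using assms(2) g(3) by (auto simp: symmetric_set_def)
  moreover have "act (- g) y = x"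
    using assms(1) g(4) unfolding is_action_def by (metis left_minus)
  ultimately show "(y, x) \<in> orbit_rel act D X" using g by (auto simp: orbit_rel_def)
qed

lemma orbit_graph_is_graph:
  assumes "is_action act" and "\<And>i. symmetric_set (\<Delta> i)" and "\<And>i. 0 \<in> \<Delta> i"
  shows "irrefl (orbit_graph act \<Delta> i j)" and "sym (orbit_graph act \<Delta> i j)"
proof -
  show "irrefl (orbit_graph act \<Delta> i j)"
    using assms(1,3) by (auto simp: irrefl_def orbit_graph_def orbit_rel_def is_action_def)
  show "sym (orbit_graph act \<Delta> i j)"
    using orbit_rel_sym[OF assms(1), of "\<Delta> i" UNIV] orbit_rel_sym[OF assms(1), of "\<Delta> j" UNIV] assms(2)
    unfolding orbit_graph_def sym_def by blast
qed

end

theory Submission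
  imports Defs
begin

text \<open>
  A complete left-invariant metric \<open>d\<close> yields the length function \<open>\<rho> g = d 0 g\<close>, and the colorings
  split the sets \<open>B n\<close> into Borel pieces on which points that are \<open>\<epsilon>\<close>-near along the orbit are already
  \<open>\<epsilon> / 4\<close>-near, so that \<open>\<epsilon>\<close>-nearness is an equivalence relation on each piece. The points whose orbit
  meets a given piece \<open>D\<close> nonmeagerly (in the sense of the group) form an invariant Borel set, by Vaught
  transforms, and these sets cover the space because countably many meager sets do not cover the group.

  Within \<open>D\<close>, passing successively to the first color that is attained nonmeagerly gives, in each class
  of \<open>\<epsilon>\<close>-nearness that \<open>D\<close> meets nonmeagerly, a decreasing sequence of nonempty subsets whose
  diameters along the orbit vanish. By completeness they shrink to a point of the orbit, and
  the set of these limits is lacunary. Choosing colors by category rather than by nonemptiness keeps every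
  set involved Borel.
\<close>

section \<open>Meager sets and Vaught transforms\<close>

text \<open>Covers by closed sets with empty interior make subsets immediate and have the form in
  which the Baire category theorem applies.\<close>

definition meager :: "'a::topological_space set \<Rightarrow> bool" where
  "meager S \<longleftrightarrow> (\<exists>\<G>. countable \<G> \<and> (\<forall>T\<in>\<G>. closed T \<and> interior T = {}) \<and> S \<subseteq> \<Union>\<G>)"

lemma meager_subset: "meager T \<Longrightarrow> S \<subseteq> T \<Longrightarrow> meager S"
  unfolding meager_def by (elim exE, rule exI) auto

lemma meager_empty: "meager {}"
  unfolding meager_def by (rule exI[of _ "{}"]) simp

lemma meager_closed: "closed T \<Longrightarrow> interior T = {} \<Longrightarrow> meager T"
  unfolding meager_def by (rule exI[of _ "{T}"]) simp

lemma meager_UN: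
  assumes "countable I" and "\<And>i. i \<in> I \<Longrightarrow> meager (S i)"
  shows "meager (\<Union>i\<in>I. S i)"
proof -
  have "\<forall>i\<in>I. \<exists>\<G>. countable \<G> \<and> (\<forall>T\<in>\<G>. closed T \<and> interior T = {}) \<and> S i \<subseteq> \<Union>\<G>"
    using assms(2) unfolding meager_def by simp
  from bchoice[OF this] obtain G where
    G: "\<forall>i\<in>I. countable (G i) \<and> (\<forall>T\<in>G i. closed T \<and> interior T = {}) \<and> S i \<subseteq> \<Union>(G i)" ..
  show ?thesis
    unfolding meager_def
  proof (intro exI[of _ "\<Union>i\<in>I. G i"] conjI)
    show "countable (\<Union>i\<in>I. G i)" using assms(1) G by (intro countable_UN) auto
    show "\<forall>T\<in>(\<Union>i\<in>I. G i). closed T \<and> interior T = {}" using G by blast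
    show "(\<Union>i\<in>I. S i) \<subseteq> \<Union>(\<Union>i\<in>I. G i)"
    proof
      fix x assume "x \<in> (\<Union>i\<in>I. S i)"
      then obtain i where i: "i \<in> I" "x \<in> S i" by blast
      from G i(1) have "S i \<subseteq> \<Union>(G i)" by simp
      with i(2) have "x \<in> \<Union>(G i)" by (rule subsetD[rotated])
      then show "x \<in> \<Union>(\<Union>i\<in>I. G i)" using i(1) by blast
    qed
  qed
qed

lemma meager_Un: "meager S \<Longrightarrow> meager T \<Longrightarrow> meager (S \<union> T)"
  using meager_UN[of "UNIV :: bool set" "\<lambda>b. if b then S else T"] by (simp add: UNIV_bool Un_commute)

text \<open>This is the Baire category theorem. Completeness comes from the metric of the class
  \<open>polish_space\<close>, not from an invariant metric.\<close>

lemma meager_open_imp_empty: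
  fixes U :: "'a::polish_space set"
  assumes "meager U" and "open U"
  shows "U = {}"
proof -
  obtain \<G> where \<G>: "countable \<G>" "\<And>T. T \<in> \<G> \<Longrightarrow> closed T \<and> interior T = {}" "U \<subseteq> \<Union>\<G>"
    using assms(1) unfolding meager_def by blast
  have "Met_TC.mcomplete TYPE('a)"
    using complete_UNIV by simp
  from Met_TC.metric_Baire_category_alt[OF this \<G>(1)] \<G>(2)
  have "interior (\<Union>\<G>) = {}"
    by simp
  then show ?thesis
    using \<G>(3) assms(2) interior_maximal by blast
qed

text \<open>A right translation is a homeomorphism, so it pulls closed sets with empty interior back
  to such sets.\<close>

lemma meager_translate:
  fixes S :: "'g::topological_group_add set"
  assumes "meager S"
  shows "meager {w. w + h \<in> S}"
proof -
  obtain \<G> where \<G>: "countable \<G>" "\<And>T. T \<in> \<G> \<Longrightarrow> closed T \<and> interior T = {}" "S \<subseteq> \<Union>\<G>"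
    using assms unfolding meager_def by blast
  have tr: "continuous_on UNIV (\<lambda>w. w + k)" for k :: 'g
    by (intro continuous_intros)
  have "meager {w. w + h \<in> T}" if "T \<in> \<G>" for T
  proof (rule meager_closed)
    show "closed {w. w + h \<in> T}"
      using closed_vimage[OF _ tr, of T h] \<G>(2)[OF that] by (simp add: vimage_def)
    show "interior {w. w + h \<in> T} = {}"
    proof (rule ccontr)
      let ?W = "interior {w. w + h \<in> T}"
      assume "?W \<noteq> {}"
      then obtain w where w: "w \<in> ?W" by blast
      have "open ((\<lambda>v. v + (- h)) -` ?W)"
        by (rule open_vimage[OF _ tr]) simp
      moreover have "(\<lambda>v. v + (- h)) -` ?W \<subseteq> T"
      proof
        fix v assume "v \<in> (\<lambda>v. v + (- h)) -` ?W"
        then have "v + (- h) \<in> {w. w + h \<in> T}" using interior_subset by blast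
        then show "v \<in> T" by (simp add: add.assoc)
      qed
      moreover have "w + h \<in> (\<lambda>v. v + (- h)) -` ?W"
        using w by (simp add: add.assoc)
      ultimately have "w + h \<in> interior T"
        using interior_maximal by blast
      then show False using \<G>(2)[OF that] by simp
    qed
  qed
  then have "meager (\<Union>T\<in>\<G>. {w. w + h \<in> T})"
    by (rule meager_UN[OF \<G>(1)])
  then show ?thesis
    by (rule meager_subset) (use \<G>(3) in auto)
qed

section \<open>Sets that are open up to a meager set\<close>

definition baire_property :: "'a::topological_space set \<Rightarrow> bool" where
  "baire_property S \<longleftrightarrow> (\<exists>W. open W \<and> meager ((S - W) \<union> (W - S)))"

lemma baire_property_open: "open S \<Longrightarrow> baire_property S"
  unfolding baire_property_def using meager_empty by (intro exI[of _ S]) auto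

text \<open>The frontier of an open set is closed with empty interior, so \<open>W\<close> may be
  replaced by its closure, whose complement is open.\<close>

lemma baire_property_Compl:
  assumes "baire_property S"
  shows "baire_property (- S)"
proof -
  obtain W where W: "open W" "meager ((S - W) \<union> (W - S))"
    using assms unfolding baire_property_def by blast
  have "meager (frontier W)"
  proof (rule meager_closed)
    show "interior (frontier W) = {}"
    proof -
      have "interior (frontier W) \<inter> W = {}"
        using interior_subset[of "frontier W"] W(1) by (auto simp: frontier_def interior_open)
      then have "interior (frontier W) \<inter> closure W = {}"
        using open_Int_closure_eq_empty[of "interior (frontier W)" W] by simp
      then show ?thesis
        using interior_subset[of "frontier W"] by (auto simp: frontier_def)
    qed
  qed (rule frontier_closed)
  then have "meager (((S - W) \<union> (W - S)) \<union> frontier W)"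
    by (rule meager_Un[OF W(2)])
  then have "meager ((- S - (- closure W)) \<union> (- closure W - (- S)))"
    by (rule meager_subset)
       (use W(1) closure_subset[of W] in \<open>auto simp: frontier_def interior_open\<close>)
  then show ?thesis
    unfolding baire_property_def by (intro exI[of _ "- closure W"]) auto
qed

lemma baire_property_UN:
  fixes S :: "nat \<Rightarrow> 'a::topological_space set"
  assumes "\<And>i. baire_property (S i)"
  shows "baire_property (\<Union>i. S i)"
proof -
  have "\<forall>i. \<exists>W. open W \<and> meager ((S i - W) \<union> (W - S i))"
    using assms unfolding baire_property_def by simp
  from choice[OF this] obtain W where W: "\<And>i. open (W i) \<and> meager ((S i - W i) \<union> (W i - S i))"
    by auto
  have "meager (\<Union>i. (S i - W i) \<union> (W i - S i))"
    by (rule meager_UN) (use W in auto)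
  then have "meager (((\<Union>i. S i) - (\<Union>i. W i)) \<union> ((\<Union>i. W i) - (\<Union>i. S i)))"
    by (rule meager_subset) blast
  then show ?thesis
    unfolding baire_property_def using W by (intro exI[of _ "\<Union>i. W i"]) auto
qed

section \<open>Vaught transforms\<close>

definition vaught :: "('g \<Rightarrow> 'x \<Rightarrow> 'x) \<Rightarrow> 'g::topological_space set \<Rightarrow> 'x set \<Rightarrow> 'x set" where
  "vaught act U A = {x. \<not> meager {g \<in> U. act g x \<in> A}}"

lemma vaught_UN:
  fixes A :: "nat \<Rightarrow> 'x set"
  shows "vaught act U (\<Union>i. A i) = (\<Union>i. vaught act U (A i))"
proof -
  have eq: "{g \<in> U. act g x \<in> (\<Union>i. A i)} = (\<Union>i. {g \<in> U. act g x \<in> A i})" for x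
    by auto
  have "meager (\<Union>i. {g \<in> U. act g x \<in> A i}) \<longleftrightarrow> (\<forall>i. meager {g \<in> U. act g x \<in> A i})" for x
    using meager_UN[of UNIV "\<lambda>i. {g \<in> U. act g x \<in> A i}"]
      meager_subset[of "\<Union>i. {g \<in> U. act g x \<in> A i}"] by blast
  then show ?thesis
    unfolding vaught_def eq by auto
qed

text \<open>A set with the Baire property that is nonmeager in \<open>U\<close> contains all but a
  meager part of some basic \<open>V\<close>, where its complement is meager. The converse inclusion
  is the Baire category theorem in \<open>V\<close>.\<close>

lemma vaught_Compl:
  fixes act :: "'g::polish_space \<Rightarrow> 'x \<Rightarrow> 'x"
  assumes "open U" and bp: "\<And>x. baire_property {g. act g x \<in> A}"
    and \<B>: "topological_basis \<B>"
  shows "vaught act U (- A) = (\<Union>V\<in>{V\<in>\<B>. V \<noteq> {} \<and> V \<subseteq> U}. - vaught act V A)"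
proof (intro equalityI subsetI)
  fix x assume x: "x \<in> vaught act U (- A)"
  let ?S = "{g. act g x \<in> A}"
  obtain W where W: "open W" "meager ((- ?S - W) \<union> (W - (- ?S)))"
    using baire_property_Compl[OF bp[of x]] unfolding baire_property_def by blast
  have "U \<inter> W \<noteq> {}"
  proof
    assume "U \<inter> W = {}"
    then have "{g \<in> U. act g x \<in> - A} \<subseteq> (- ?S - W) \<union> (W - (- ?S))" by auto
    then show False using x W(2) meager_subset unfolding vaught_def by blast
  qed
  then obtain g where "g \<in> U \<inter> W" by blast
  then obtain V where V: "V \<in> \<B>" "g \<in> V" "V \<subseteq> U \<inter> W"
    using topological_basisE[OF \<B>, of "U \<inter> W" g] W(1) assms(1) by (metis open_Int)
  have "meager {g \<in> V. act g x \<in> A}"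
    by (rule meager_subset[OF W(2)]) (use V in auto)
  then show "x \<in> (\<Union>V\<in>{V\<in>\<B>. V \<noteq> {} \<and> V \<subseteq> U}. - vaught act V A)"
    using V unfolding vaught_def by auto
next
  fix x assume "x \<in> (\<Union>V\<in>{V\<in>\<B>. V \<noteq> {} \<and> V \<subseteq> U}. - vaught act V A)"
  then obtain V where V: "V \<in> \<B>" "V \<noteq> {}" "V \<subseteq> U" "meager {g \<in> V. act g x \<in> A}"
    unfolding vaught_def by auto
  show "x \<in> vaught act U (- A)"
    unfolding vaught_def
  proof (simp, rule notI)
    assume "meager {g \<in> U. act g x \<notin> A}"
    then have "meager ({g \<in> U. act g x \<notin> A} \<union> {g \<in> V. act g x \<in> A})"
      by (rule meager_Un[OF _ V(4)])
    then have "meager V"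
      by (rule meager_subset) (use V(3) in auto)
    then show False
      using meager_open_imp_empty topological_basis_open[OF \<B> V(1)] V(2) by blast
  qed
qed

lemma sets_borel_vaught:
  fixes act :: "'g::polish_space \<Rightarrow> 'x::topological_space \<Rightarrow> 'x"
  assumes cont_g: "\<And>x. continuous_on UNIV (\<lambda>g. act g x)"
    and cont_x: "\<And>g. continuous_on UNIV (act g)"
    and A: "A \<in> sets borel" and U: "open U"
  shows "vaught act U A \<in> sets borel"
proof -
  obtain \<B> :: "'g set set" where \<B>: "countable \<B>" "topological_basis \<B>"
    using ex_countable_basis by blast
  have "A \<in> sigma_sets UNIV {S. open S}"
    using A by (simp add: borel_def)
  \<comment> \<open>All open \<open>U\<close> are treated at once because complements refer to
    smaller basic sets; the Baire property is carried along because \<open>vaught_Compl\<close> asks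
    for it.\<close>
  then have "(\<forall>x. baire_property {g. act g x \<in> A}) \<and> (\<forall>U. open U \<longrightarrow> vaught act U A \<in> sets borel)"
  proof (induction rule: sigma_sets.induct)
    case (Basic A)
    then have opn: "open {g. act g x \<in> A}" for x
      using open_vimage[OF _ cont_g, of A x] by (simp add: vimage_def)
    have "vaught act U A \<in> sets borel" if "open U" for U
    proof -
      \<comment> \<open>For open \<open>A\<close> the relevant set of \<open>g\<close> is open, so
        it is nonmeager as soon as it is nonempty.\<close>
      have "vaught act U A = (\<Union>g\<in>U. act g -` A)"
      proof (intro equalityI subsetI)
        fix x assume "x \<in> vaught act U A"
        then have "{g \<in> U. act g x \<in> A} \<noteq> {}"
          unfolding vaught_def using meager_empty by (metis (lifting) mem_Collect_eq)
        then show "x \<in> (\<Union>g\<in>U. act g -` A)" by auto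
      next
        fix x assume "x \<in> (\<Union>g\<in>U. act g -` A)"
        moreover have "open {g \<in> U. act g x \<in> A}"
          using open_Int[OF that opn[of x]] by (simp add: Int_def)
        ultimately show "x \<in> vaught act U A"
          unfolding vaught_def using meager_open_imp_empty by auto
      qed
      moreover have "open (\<Union>g\<in>U. act g -` A)"
        using open_vimage[OF _ cont_x] Basic by auto
      ultimately show ?thesis by simp
    qed
    then show ?case using baire_property_open[OF opn] by blast
  next
    case Empty
    show ?case
      using meager_empty by (simp add: vaught_def baire_property_open)
  next
    case (Compl A)
    have "baire_property {g. act g x \<in> UNIV - A}" for x
      using baire_property_Compl[of "{g. act g x \<in> A}"] Compl.IH by (simp add: Compl_eq)
    moreover have "vaught act U (UNIV - A) \<in> sets borel" if "open U" for U
    proof -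
      have "vaught act U (UNIV - A) = (\<Union>V\<in>{V\<in>\<B>. V \<noteq> {} \<and> V \<subseteq> U}. - vaught act V A)"
        using vaught_Compl[OF that _ \<B>(2), of act A] Compl.IH by (simp add: Compl_eq_Diff_UNIV)
      also have "\<dots> \<in> sets borel"
      proof (rule sets.countable_UN')
        show "countable {V\<in>\<B>. V \<noteq> {} \<and> V \<subseteq> U}"
          using \<B>(1) by (rule countable_subset[rotated]) auto
        have "- vaught act V A \<in> sets borel" if "V \<in> \<B>" for V
          using Compl.IH topological_basis_open[OF \<B>(2) that] by (intro borel_comp) blast
        then show "(\<lambda>V. - vaught act V A) ` {V\<in>\<B>. V \<noteq> {} \<and> V \<subseteq> U} \<subseteq> sets borel"
          by blast
      qed
      finally show ?thesis .
    qed
    ultimately show ?case by blast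
  next
    case (Union A)
    have eq: "{g. act g x \<in> (\<Union>i. A i)} = (\<Union>i. {g. act g x \<in> A i})" for x
      by auto
    have "baire_property {g. act g x \<in> (\<Union>i. A i)}" for x
      unfolding eq by (rule baire_property_UN) (use Union.IH in blast)
    moreover have "vaught act U (\<Union>i. A i) \<in> sets borel" if "open U" for U
      unfolding vaught_UN using Union.IH that by auto
    ultimately show ?case by blast
  qed
  then show ?thesis using U by blast
qed

section \<open>Actions of groups with a complete length function\<close>

text \<open>The map \<open>\<rho> (g - h)\<close> is a right-invariant metric of the group, and
  \<open>len_complete\<close> is its completeness. Right invariance suits products that grow on the
  left, as they do when an orbit is followed.\<close>

locale length_action =
  fixes \<rho> :: "'g::{topological_group_add, polish_space} \<Rightarrow> real"
    and act :: "'g \<Rightarrow> 'x::t2_space \<Rightarrow> 'x"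
  assumes len_zero: "\<rho> 0 = 0"
    and len_minus: "\<rho> (- g) = \<rho> g"
    and len_add: "\<rho> (g + h) \<le> \<rho> g + \<rho> h"
    and continuous_len: "continuous_on UNIV \<rho>"
    and len_basis: "open U \<Longrightarrow> 0 \<in> U \<Longrightarrow> \<exists>r>0. {g. \<rho> g < r} \<subseteq> U"
    and len_complete: "(\<And>e. e > 0 \<Longrightarrow> \<exists>N. \<forall>m\<ge>N. \<forall>n\<ge>N. \<rho> (s m - s n) < e) \<Longrightarrow> convergent s"
    and action: "continuous_action act"
begin

lemma act_zero [simp]: "act 0 x = x"
  and act_add: "act (g + h) x = act g (act h x)"
  using action unfolding continuous_action_def is_action_def by blast+

lemma act_minus: "act g x = y \<Longrightarrow> act (- g) y = x"
  by (metis act_add act_zero left_minus)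

lemma tendsto_act:
  assumes "(f \<longlongrightarrow> g) F" and "(u \<longlongrightarrow> x) F"
  shows "((\<lambda>n. act (f n) (u n)) \<longlongrightarrow> act g x) F"
proof -
  have "isCont (\<lambda>(g, x). act g x) (g, x)"
    using action continuous_on_eq_continuous_at[OF open_UNIV]
    unfolding continuous_action_def by blast
  from isCont_tendsto_compose[OF this tendsto_Pair[OF assms]] show ?thesis
    by simp
qed

lemma continuous_act: "continuous_on UNIV (\<lambda>g. act g x)" "continuous_on UNIV (act g)"
  by (auto simp: continuous_on_def intro!: tendsto_act)

lemma len_nonneg: "0 \<le> \<rho> g"
  using len_add[of g "- g"] by (simp add: len_zero len_minus)

lemma open_len_ball: "open {g. \<rho> g < r}"
  using open_Collect_less[OF continuous_len continuous_on_const] .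

lemma sets_vaught: "A \<in> sets borel \<Longrightarrow> open U \<Longrightarrow> vaught act U A \<in> sets borel"
  by (rule sets_borel_vaught[OF continuous_act])

section \<open>The pseudometric along orbits: infimal length of an element moving one point to the
  other\<close>

definition near :: "real \<Rightarrow> 'x \<Rightarrow> 'x \<Rightarrow> bool" where
  "near r x y \<longleftrightarrow> (\<exists>g. \<rho> g < r \<and> act g x = y)"

lemma near_sym: "near r x y \<Longrightarrow> near r y x"
  unfolding near_def using act_minus len_minus by metis

lemma near_trans:
  assumes "near r x y" and "near s y z"
  shows "near (r + s) x z"
proof -
  obtain g h where g: "\<rho> g < r" "act g x = y" and h: "\<rho> h < s" "act h y = z"
    using assms unfolding near_def by blast
  have "\<rho> (h + g) < r + s" using len_add[of h g] g(1) h(1) by linarith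
  moreover have "act (h + g) x = z" using g(2) h(2) by (simp add: act_add)
  ultimately show ?thesis unfolding near_def by blast
qed

lemma near_mono: "near r x y \<Longrightarrow> r \<le> s \<Longrightarrow> near s x y"
  unfolding near_def by (elim exE conjE, intro exI conjI) (erule (1) order_less_le_trans)

text \<open>The elements that keep \<open>x\<close> inside a neighborhood missing \<open>y\<close>
  form a neighborhood of the identity, which contains a ball of \<open>\<rho>\<close>.\<close>

lemma near_all_imp_eq:
  assumes "\<And>r. r > 0 \<Longrightarrow> near r x y"
  shows "x = y"
proof (rule ccontr)
  assume "x \<noteq> y"
  then obtain U where U: "open U" "x \<in> U" "y \<notin> U"
    using t1_space by blast
  have "open {g. act g x \<in> U}"
    using open_vimage[OF U(1) continuous_act(1), of x] by (simp add: vimage_def)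
  then obtain r where "r > 0" "{g. \<rho> g < r} \<subseteq> {g. act g x \<in> U}"
    using len_basis[of "{g. act g x \<in> U}"] U(2) by auto
  then show False
    using assms[of r] U(3) unfolding near_def by auto
qed

text \<open>If \<open>S\<close> were meager around each of its points, countably many of these
  neighborhoods would cover it by the Lindelof property, and \<open>S\<close> would be
  meager.\<close>

lemma nonmeager_local:
  assumes "\<not> meager S" and "r > 0"
  shows "\<exists>g\<in>S. \<not> meager {w. \<rho> w < r \<and> w + g \<in> S}"
proof (rule ccontr)
  assume "\<not> (\<exists>g\<in>S. \<not> meager {w. \<rho> w < r \<and> w + g \<in> S})"
  then have m: "meager {w. \<rho> w < r \<and> w + g \<in> S}" if "g \<in> S" for g
    using that by blast
  \<comment> \<open>This is the right translate by \<open>g\<close> of the \<open>r\<close>-ball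
    around the identity, so \<open>S \<inter> W g\<close> is a translate of the set in
    \<open>m\<close>.\<close>
  define W where "W g = {v. \<rho> (v - g) < r}" for g
  have "open (W g)" for g
  proof -
    have "continuous_on UNIV (\<lambda>v. \<rho> (v - g))"
      by (rule continuous_on_compose2[OF continuous_len]) (intro continuous_intros, simp)
    from open_Collect_less[OF this continuous_on_const] show ?thesis
      unfolding W_def .
  qed
  then obtain \<F> where \<F>: "\<F> \<subseteq> W ` S" "countable \<F>" "\<Union>\<F> = \<Union>(W ` S)"
    using Lindelof[of "W ` S"] by (metis (no_types, lifting) imageE)
  have "meager (S \<inter> T)" if T: "T \<in> \<F>" for T
  proof -
    obtain g where g: "g \<in> S" "T = W g" using \<F>(1) T by blast
    show ?thesis
      by (rule meager_subset[OF meager_translate[OF m[OF g(1)], of "- g"]])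
         (auto simp: g(2) W_def add.assoc)
  qed
  then have "meager (\<Union>T\<in>\<F>. S \<inter> T)"
    by (rule meager_UN[OF \<F>(2)])
  moreover have "S \<subseteq> (\<Union>T\<in>\<F>. S \<inter> T)"
  proof
    fix g assume "g \<in> S"
    moreover have "g \<in> W g" using assms(2) by (simp add: W_def len_zero)
    ultimately show "g \<in> (\<Union>T\<in>\<F>. S \<inter> T)" using \<F>(3) by blast
  qed
  ultimately have "meager S" by (rule meager_subset)
  with assms(1) show False ..
qed

text \<open>
  The elements of \<open>S\<close> themselves may be long: they are only short modulo the stabilizer,
  which is what countably many translates of a small ball take care of.
\<close>
lemma nonmeager_transfer:
  assumes "\<not> meager S" and "t > 0"
    and S: "\<And>g. g \<in> S \<Longrightarrow> act g x \<in> A \<and> near s y (act g x)"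
  shows "y \<in> vaught act {g. \<rho> g < s + t} A"
proof -
  obtain g where g: "g \<in> S" "\<not> meager {w. \<rho> w < t \<and> w + g \<in> S}"
    using nonmeager_local[OF assms(1,2)] by blast
  obtain h where h: "\<rho> h < s" "act h y = act g x"
    using S[OF g(1)] unfolding near_def by blast
  let ?T = "{k \<in> {g. \<rho> g < s + t}. act k y \<in> A}"
  \<comment> \<open>As \<open>h\<close> moves \<open>y\<close> to where \<open>g\<close> moves
    \<open>x\<close>, \<open>w + h\<close> takes \<open>y\<close> to where \<open>w + g\<close>
    takes \<open>x\<close>, and \<open>h\<close> is short.\<close>
  have sub: "{w. \<rho> w < t \<and> w + g \<in> S} \<subseteq> {w. w + h \<in> ?T}"
  proof clarify
    fix w assume w: "\<rho> w < t" "w + g \<in> S"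
    have "\<rho> (w + h) < s + t" using len_add[of w h] w(1) h(1) by linarith
    moreover have "act (w + h) y \<in> A"
      using S[OF w(2)] h(2) by (simp add: act_add)
    ultimately show "w + h \<in> {g. \<rho> g < s + t} \<and> act (w + h) y \<in> A" by simp
  qed
  have "\<not> meager ?T"
  proof
    assume "meager ?T"
    from meager_subset[OF meager_translate[OF this] sub] g(2) show False by contradiction
  qed
  then show ?thesis by (simp add: vaught_def)
qed

lemma vaught_UNIV_act:
  assumes "x \<in> vaught act UNIV A"
  shows "act h x \<in> vaught act UNIV A"
proof -
  have "meager {g. act g x \<in> A}" if "meager {g. act g (act h x) \<in> A}"
    using meager_translate[OF that, of "- h"] by (simp add: act_add[symmetric] add.assoc)
  then show ?thesis
    using assms unfolding vaught_def by auto
qed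

lemma convergent_summable_steps:
  assumes "\<And>n. \<rho> (s (Suc n) - s n) < a * (1/2)^n"
  obtains l where "s \<longlonglongrightarrow> l" and "\<And>n. \<rho> (l - s n) \<le> 2 * a * (1/2)^n"
proof -
  have a: "0 < a"
    using assms[of 0] len_nonneg[of "s (Suc 0) - s 0"] by simp
  \<comment> \<open>The factor \<open>1 - (1/2)^k\<close> gives the exact partial sum of the
    geometric series; without it the bound would not survive the induction step.\<close>
  have far: "\<rho> (s (n + k) - s n) \<le> 2 * a * (1/2)^n * (1 - (1/2)^k)" for n k
  proof (induction k)
    case 0
    then show ?case by (simp add: len_zero)
  next
    case (Suc k)
    have "s (n + Suc k) - s n = (s (Suc (n + k)) - s (n + k)) + (s (n + k) - s n)"
      by (simp only: diff_conv_add_uminus add.assoc minus_add_cancel add_Suc_right)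
    then have "\<rho> (s (n + Suc k) - s n) = \<rho> ((s (Suc (n + k)) - s (n + k)) + (s (n + k) - s n))"
      by (rule arg_cong)
    also have "\<dots> \<le> a * (1/2)^(n + k) + 2 * a * (1/2)^n * (1 - (1/2)^k)"
      using len_add[of "s (Suc (n + k)) - s (n + k)" "s (n + k) - s n"] assms[of "n + k"] Suc by linarith
    also have "\<dots> = 2 * a * (1/2)^n * (1 - (1/2)^Suc k)"
      by (simp add: power_add algebra_simps)
    finally show ?case .
  qed
  have far': "\<rho> (s m - s n) \<le> 2 * a * (1/2)^n" if "n \<le> m" for m n
  proof -
    have "2 * a * (1/2)^n * (1 - (1/2)^(m - n)) \<le> 2 * a * (1/2)^n * 1"
      using a by (intro mult_left_mono) auto
    then show ?thesis using far[of n "m - n"] that by simp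
  qed
  have "convergent s"
  proof (rule len_complete)
    fix e :: real assume "e > 0"
    then obtain N where N: "(1/2::real)^N < e / (2 * a)"
      using real_arch_pow_inv[of "e / (2 * a)" "1/2"] a by auto
    have "\<rho> (s m - s n) < e" if "N \<le> m" "N \<le> n" for m n
    proof -
      have *: "\<rho> (s m - s n) \<le> 2 * a * (1/2)^N" if "N \<le> n" "n \<le> m" for m n
      proof -
        have "(1/2::real)^n \<le> (1/2)^N" using that(1) by (intro power_decreasing) auto
        then have "2 * a * (1/2)^n \<le> 2 * a * (1/2)^N" using a by simp
        then show ?thesis using far'[OF that(2)] by linarith
      qed
      have "\<rho> (s m - s n) = \<rho> (s n - s m)"
        using len_minus[of "s m - s n"] by simp
      then have "\<rho> (s m - s n) \<le> 2 * a * (1/2)^N"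
        using *[of n m] *[of m n] that by (cases "n \<le> m") auto
      also have "\<dots> < e" using N a by (simp add: field_simps)
      finally show ?thesis .
    qed
    then show "\<exists>N. \<forall>m\<ge>N. \<forall>n\<ge>N. \<rho> (s m - s n) < e" by blast
  qed
  then obtain l where l: "s \<longlonglongrightarrow> l" unfolding convergent_def by blast
  have "\<rho> (l - s n) \<le> 2 * a * (1/2)^n" for n
  proof (rule LIMSEQ_le_const2)
    have "isCont \<rho> (l - s n)"
      using continuous_len by (simp add: continuous_on_eq_continuous_at)
    then show "(\<lambda>m. \<rho> (s m - s n)) \<longlonglongrightarrow> \<rho> (l - s n)"
      by (rule isCont_tendsto_compose) (intro tendsto_intros l)
    show "\<exists>N. \<forall>m\<ge>N. \<rho> (s m - s n) \<le> 2 * a * (1/2)^n"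
      using far' by blast
  qed
  then show thesis using that l by blast
qed

end

section \<open>Lacunary sections from colorings\<close>

text \<open>By \<open>near_B\<close>, nearness at scale \<epsilon> is transitive on
  \<open>B\<close>, as \<epsilon> / 4 + \<epsilon> / 4 is below \<epsilon>. The 20 in
  \<open>near_color\<close> lets five errors of that size fit into the radius
  \<open>\<epsilon> / 4 * (1/2)^p\<close> of \<open>limit_set\<close>.\<close>

locale colored_set = length_action +
  fixes B :: "'b::t2_space set" and \<epsilon> :: real and c :: "nat \<Rightarrow> 'b \<Rightarrow> nat"
  assumes sets_B: "B \<in> sets borel"
    and eps_pos: "0 < \<epsilon>"
    and near_B: "x \<in> B \<Longrightarrow> y \<in> B \<Longrightarrow> near \<epsilon> x y \<Longrightarrow> near (\<epsilon> / 4) x y"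
    and sets_color: "{x \<in> B. c p x = k} \<in> sets borel"
    and near_color: "x \<in> B \<Longrightarrow> y \<in> B \<Longrightarrow> near \<epsilon> x y \<Longrightarrow> c p x = c p y \<Longrightarrow>
      near (\<epsilon> / 20 * (1/2)^p) x y"
begin

text \<open>The radius does not grow: a point of \<open>A\<close> within \<epsilon> / 2 of
  \<open>x\<close> is within 3 \<epsilon> / 4 of \<open>y\<close>, hence within \<epsilon> / 4 by
  \<open>near_B\<close>, and \<open>nonmeager_transfer\<close> adds another \<epsilon> / 4.\<close>

lemma vaught_near:
  assumes "x \<in> B" "y \<in> B" "near \<epsilon> x y" "A \<subseteq> B"
    and x: "x \<in> vaught act {g. \<rho> g < \<epsilon> / 2} A"
  shows "y \<in> vaught act {g. \<rho> g < \<epsilon> / 2} A"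
proof -
  have "y \<in> vaught act {g. \<rho> g < \<epsilon> / 4 + \<epsilon> / 4} A"
  proof (rule nonmeager_transfer)
    show "\<not> meager {g \<in> {g. \<rho> g < \<epsilon> / 2}. act g x \<in> A}"
      using x by (simp add: vaught_def)
    show "\<epsilon> / 4 > 0" using eps_pos by simp
    fix g assume "g \<in> {g \<in> {g. \<rho> g < \<epsilon> / 2}. act g x \<in> A}"
    then have g: "\<rho> g < \<epsilon> / 2" "act g x \<in> A" by auto
    have "near (\<epsilon> / 4) y x"
      by (rule near_sym, rule near_B) (use assms in auto)
    moreover have "near (\<epsilon> / 2) x (act g x)" using g(1) by (auto simp: near_def)
    ultimately have "near (\<epsilon> / 4 + \<epsilon> / 2) y (act g x)" by (rule near_trans)
    then have "near \<epsilon> y (act g x)" by (rule near_mono) (use eps_pos in simp)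
    then have "near (\<epsilon> / 4) y (act g x)" using near_B assms(2,4) g(2) by blast
    with g(2) show "act g x \<in> A \<and> near (\<epsilon> / 4) y (act g x)" by blast
  qed
  then show ?thesis by simp
qed

section \<open>Selection of colors by category\<close>

text \<open>If no color qualifies, \<open>LEAST\<close> gives an unspecified value, yet one
  depending only on the set of qualifying colors, so \<open>first_color_near\<close> holds in that
  case as well.\<close>

definition first_color :: "nat \<Rightarrow> 'b set \<Rightarrow> 'b \<Rightarrow> nat" where
  "first_color p A x = (LEAST k. x \<in> vaught act {g. \<rho> g < \<epsilon> / 2} {y \<in> A. c p y = k})"

lemma first_color_near:
  assumes "x \<in> B" "y \<in> B" "near \<epsilon> x y" "A \<subseteq> B"
  shows "first_color p A x = first_color p A y"
proof -
  have "x \<in> vaught act {g. \<rho> g < \<epsilon> / 2} {y \<in> A. c p y = k} \<longleftrightarrow>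
      y \<in> vaught act {g. \<rho> g < \<epsilon> / 2} {y \<in> A. c p y = k}" for k
    using vaught_near[OF assms(1-3), of "{y \<in> A. c p y = k}"]
      vaught_near[OF assms(2,1) near_sym[OF assms(3)], of "{y \<in> A. c p y = k}"] assms(4) by auto
  then show ?thesis unfolding first_color_def by simp
qed

text \<open>
  A point is retained if its own color is the generically first one in its piece of the orbit.
  As the latter color depends only on that piece, no infinite sequence of colors has to be chosen.
\<close>
primrec selected :: "nat \<Rightarrow> 'b set" where
  "selected 0 = B"
| "selected (Suc p) = {x \<in> selected p. c p x = first_color p (selected p) x}"

lemma selected_subset: "selected p \<subseteq> B"
  by (induction p) auto

text \<open>\<open>first_color\<close> is the least index in a sequence of Vaught transforms, which
  are Borel; comparing it with \<open>c p\<close> splits into countably many values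
  \<open>k\<close>.\<close>

lemma sets_selected: "selected p \<in> sets borel"
proof (induction p)
  case 0
  then show ?case by (simp add: sets_B)
next
  case (Suc p)
  have col: "{x \<in> selected p. c p x = k} \<in> sets borel" for k
  proof -
    have "{x \<in> selected p. c p x = k} = selected p \<inter> {x \<in> B. c p x = k}"
      using selected_subset by auto
    then show ?thesis using Suc sets_color by simp
  qed
  have "first_color p (selected p) -` {k} \<inter> space borel \<in> sets borel" for k
    unfolding first_color_def
    by (rule sets_Least) (simp only: space_borel UNIV_I simp_thms Collect_mem_eq sets_vaught[OF col open_len_ball])
  then have "(\<Union>k. {x \<in> selected p. c p x = k} \<inter> first_color p (selected p) -` {k}) \<in> sets borel"
    using col by auto
  moreover have "selected (Suc p) = (\<Union>k. {x \<in> selected p. c p x = k} \<inter> first_color p (selected p) -` {k})"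
    by auto
  ultimately show ?case by simp
qed

text \<open>Near points of \<open>B\<close> share the first color, which retained points carry as
  their own, so \<open>near_color\<close> applies. Index \<open>Suc p\<close> means that the
  coloring \<open>c p\<close> has been used.\<close>

lemma selected_near:
  assumes "x \<in> selected (Suc p)" "y \<in> selected (Suc p)" "near \<epsilon> x y"
  shows "near (\<epsilon> / 20 * (1/2)^p) x y"
proof (rule near_color)
  show B: "x \<in> B" "y \<in> B" using assms selected_subset by blast+
  show "c p x = c p y"
    using assms first_color_near[OF B assms(3) selected_subset] by simp
qed (rule assms(3))

text \<open>Countably many colors exhaust \<open>selected p\<close>, so one is attained nonmeagerly.
  Points near \<open>x\<close> with the first such color have the same first color as
  \<open>x\<close>, so they are retained.\<close>

lemma vaught_selected:
  assumes "x \<in> B" and "x \<in> vaught act {g. \<rho> g < \<epsilon> / 2} B"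
  shows "x \<in> vaught act {g. \<rho> g < \<epsilon> / 2} (selected p)"
proof (induction p)
  case 0
  then show ?case using assms by simp
next
  case (Suc p)
  let ?V = "vaught act {g. \<rho> g < \<epsilon> / 2}" and ?k = "first_color p (selected p)"
  have eq: "selected p = (\<Union>k. {y \<in> selected p. c p y = k})" by auto
  have "x \<in> ?V (\<Union>k. {y \<in> selected p. c p y = k})"
    using Suc by (subst eq[symmetric])
  then have "\<exists>k. x \<in> ?V {y \<in> selected p. c p y = k}"
    unfolding vaught_UN by blast
  then have V: "x \<in> ?V {y \<in> selected p. c p y = ?k x}"
    unfolding first_color_def by (rule LeastI_ex)
  have sub: "{g \<in> {g. \<rho> g < \<epsilon> / 2}. act g x \<in> {y \<in> selected p. c p y = ?k x}}
      \<subseteq> {g \<in> {g. \<rho> g < \<epsilon> / 2}. act g x \<in> selected (Suc p)}"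
  proof
    fix g assume "g \<in> {g \<in> {g. \<rho> g < \<epsilon> / 2}. act g x \<in> {y \<in> selected p. c p y = ?k x}}"
    then have g: "\<rho> g < \<epsilon> / 2" "act g x \<in> selected p" "c p (act g x) = ?k x" by simp_all
    have "near (\<epsilon> / 2) x (act g x)" using g(1) by (auto simp: near_def)
    then have "near \<epsilon> x (act g x)" by (rule near_mono) (use eps_pos in simp)
    then have "?k x = ?k (act g x)"
      using first_color_near assms(1) g(2) selected_subset by blast
    then show "g \<in> {g \<in> {g. \<rho> g < \<epsilon> / 2}. act g x \<in> selected (Suc p)}" using g by simp
  qed
  have "\<not> meager {g \<in> {g. \<rho> g < \<epsilon> / 2}. act g x \<in> selected (Suc p)}"
  proof
    assume "meager {g \<in> {g. \<rho> g < \<epsilon> / 2}. act g x \<in> selected (Suc p)}"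
    from meager_subset[OF this sub] V show False
      unfolding vaught_def by blast
  qed
  then show ?case unfolding vaught_def by blast
qed

section \<open>Limits of the selected sets\<close>

text \<open>Closeness to each selected set is asked for nonmeagerly many \<open>g\<close>: the mere
  existence of \<open>g\<close> would be a projection, which need not be Borel.\<close>

definition limit_set :: "'b set" where
  "limit_set = (\<Inter>p. vaught act {g. \<rho> g < \<epsilon> / 4 * (1/2)^p} (selected (Suc p)))"

lemma sets_limit_set: "limit_set \<in> sets borel"
  unfolding limit_set_def using sets_vaught[OF sets_selected open_len_ball] by blast

lemma limit_set_near:
  assumes "z \<in> limit_set"
  obtains b where "b \<in> selected (Suc n)" and "near (\<epsilon> / 4 * (1/2)^n) z b"
proof -
  have "\<not> meager {g \<in> {g. \<rho> g < \<epsilon> / 4 * (1/2)^n}. act g z \<in> selected (Suc n)}"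
    using assms unfolding limit_set_def vaught_def by blast
  then have "{g \<in> {g. \<rho> g < \<epsilon> / 4 * (1/2)^n}. act g z \<in> selected (Suc n)} \<noteq> {}"
    using meager_empty by metis
  then show thesis using that unfolding near_def by blast
qed

text \<open>Both points are within \<open>\<epsilon> / 4 * (1/2)^n\<close> of
  \<open>selected (Suc n)\<close>. The witnesses there are \<epsilon>-near, because \<epsilon> / 4 +
  \<epsilon> / 2 + \<epsilon> / 4 is \<epsilon>, and \<open>selected_near\<close> brings them
  together as \<open>n\<close> grows.\<close>

lemma limit_set_lacunary:
  assumes y: "y \<in> limit_set" and z: "z \<in> limit_set" and yz: "near (\<epsilon> / 2) y z"
  shows "y = z"
proof (rule near_all_imp_eq)
  fix r :: real assume "r > 0"
  then obtain n where n: "(1/2::real)^n < r / \<epsilon>"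
    using real_arch_pow_inv[of "r / \<epsilon>" "1/2"] eps_pos by auto
  let ?e = "\<epsilon> / 4 * (1/2)^n"
  have e: "?e \<le> \<epsilon> / 4" "0 < ?e" using eps_pos by (simp_all add: power_le_one)
  obtain b where b: "b \<in> selected (Suc n)" "near ?e y b" using limit_set_near[OF y] .
  obtain b' where b': "b' \<in> selected (Suc n)" "near ?e z b'" using limit_set_near[OF z] .
  have "near (?e + \<epsilon> / 2 + ?e) b b'"
    using near_trans[OF near_trans[OF near_sym[OF b(2)] yz] b'(2)] .
  then have "near \<epsilon> b b'" by (rule near_mono) (use e in linarith)
  then have "near (\<epsilon> / 20 * (1/2)^n) b b'" by (rule selected_near[OF b(1) b'(1)])
  then have "near (?e + \<epsilon> / 20 * (1/2)^n + ?e) y z"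
    using near_trans[OF near_trans[OF b(2)] near_sym[OF b'(2)]] by blast
  moreover have "\<epsilon> * (1/2)^n < r" using n eps_pos by (simp add: field_simps)
  then have "?e + \<epsilon> / 20 * (1/2)^n + ?e \<le> r" using e by linarith
  ultimately show "near r y z" by (rule near_mono)
qed

text \<open>Selected points near \<open>x\<close> are joined by steps of geometrically decreasing
  length. The product of the steps converges by completeness, and its limit moves the first point
  into \<open>limit_set\<close>.\<close>

lemma limit_set_meets_orbit_of_dense_point:
  assumes "x \<in> B" and "x \<in> vaught act {g. \<rho> g < \<epsilon> / 2} B"
  shows "\<exists>g. act g x \<in> limit_set"
proof -
  have V: "x \<in> vaught act {g. \<rho> g < \<epsilon> / 2} (selected p)" for p
    using vaught_selected[OF assms] .
  have "\<exists>g. \<rho> g < \<epsilon> / 2 \<and> act g x \<in> selected (Suc p)" for p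
  proof -
    have "\<not> meager {g \<in> {g. \<rho> g < \<epsilon> / 2}. act g x \<in> selected (Suc p)}"
      using V[of "Suc p"] unfolding vaught_def by blast
    then have "{g \<in> {g. \<rho> g < \<epsilon> / 2}. act g x \<in> selected (Suc p)} \<noteq> {}"
      using meager_empty by metis
    then show ?thesis by blast
  qed
  then obtain h where h: "\<And>p. \<rho> (h p) < \<epsilon> / 2" "\<And>p. act (h p) x \<in> selected (Suc p)"
    by metis
  define y where "y p = act (h p) x" for p
  have near_x: "near (\<epsilon> / 2) (y p) x" for p
    by (rule near_sym) (use h(1) in \<open>auto simp: near_def y_def\<close>)
  \<comment> \<open>Both points are within \<epsilon> / 2 of \<open>x\<close>, hence
    \<epsilon>-near, which \<open>selected_near\<close> improves.\<close>
  have y_near: "near (\<epsilon> / 20 * (1/2)^p) (y p) (act g x)"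
    if "\<rho> g < \<epsilon> / 2" "act g x \<in> selected (Suc p)" for p g
  proof (rule selected_near)
    show "y p \<in> selected (Suc p)" using h(2) by (simp add: y_def)
    have "near (\<epsilon> / 2) x (act g x)" using that(1) by (auto simp: near_def)
    from near_trans[OF near_x this] show "near \<epsilon> (y p) (act g x)" by simp
  qed (rule that(2))
  \<comment> \<open>The selected sets decrease, so \<open>y (Suc p)\<close> lies in
    \<open>selected (Suc p)\<close> as well.\<close>
  have "\<exists>\<gamma>. \<rho> \<gamma> < \<epsilon> / 20 * (1/2)^p \<and> act \<gamma> (y p) = y (Suc p)" for p
    using y_near[OF h(1)[of "Suc p"], of p] h(2)[of "Suc p"] unfolding near_def y_def by simp
  then obtain \<gamma> where \<gamma>: "\<And>p. \<rho> (\<gamma> p) < \<epsilon> / 20 * (1/2)^p" "\<And>p. act (\<gamma> p) (y p) = y (Suc p)"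
    by metis
  \<comment> \<open>New steps multiply on the left, so that \<open>s (Suc p) - s p\<close> is
    exactly \<open>\<gamma> p\<close>.\<close>
  define s where "s = rec_nat 0 (\<lambda>p u. \<gamma> p + u)"
  have s: "s 0 = 0" "s (Suc p) = \<gamma> p + s p" for p by (simp_all add: s_def)
  have act_s: "act (s p) (y 0) = y p" for p
    by (induction p) (simp_all add: s act_add \<gamma>(2))
  have "\<rho> (s (Suc p) - s p) < \<epsilon> / 20 * (1/2)^p" for p
    using \<gamma>(1) by (simp add: s add_diff_eq[symmetric])
  from convergent_summable_steps[of s, OF this] obtain l where
    l: "\<And>p. \<rho> (l - s p) \<le> 2 * (\<epsilon> / 20) * (1/2)^p" by blast
  define z where "z = act l (y 0)"
  have z: "z \<in> vaught act {g. \<rho> g < \<epsilon> / 4 * (1/2)^p} (selected (Suc p))" for p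
  proof -
    let ?e = "\<epsilon> / 20 * (1/2)^p"
    have e: "0 < ?e" using eps_pos by simp
    have "act (l - s p) (y p) = z"
      using act_add[of "l - s p" "s p" "y 0"] by (simp add: act_s z_def)
    moreover have "\<rho> (l - s p) < 3 * ?e" using l[of p] e by simp
    ultimately have "near (3 * ?e) (y p) z" unfolding near_def by blast
    then have yz: "near (3 * ?e) z (y p)" by (rule near_sym)
    \<comment> \<open>Five errors \<open>?e\<close>: three from \<open>z\<close> to
      \<open>y p\<close> (two, enlarged for a strict bound), one from \<open>y p\<close> to the
      selected points near \<open>x\<close>, one spent in \<open>nonmeager_transfer\<close>.\<close>
    have "z \<in> vaught act {g. \<rho> g < (3 * ?e + ?e) + ?e} (selected (Suc p))"
    proof (rule nonmeager_transfer)
      show "\<not> meager {g \<in> {g. \<rho> g < \<epsilon> / 2}. act g x \<in> selected (Suc p)}"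
        using V[of "Suc p"] by (simp add: vaught_def)
      show "?e > 0" by (rule e)
      fix g assume "g \<in> {g \<in> {g. \<rho> g < \<epsilon> / 2}. act g x \<in> selected (Suc p)}"
      then have g: "\<rho> g < \<epsilon> / 2" "act g x \<in> selected (Suc p)" by simp_all
      show "act g x \<in> selected (Suc p) \<and> near (3 * ?e + ?e) z (act g x)"
        using near_trans[OF yz y_near[OF g]] g(2) by blast
    qed
    moreover have "(3 * ?e + ?e) + ?e = \<epsilon> / 4 * (1/2)^p" by simp
    ultimately show ?thesis by simp
  qed
  have "act (l + h 0) x \<in> limit_set"
    using z unfolding limit_set_def z_def y_def by (simp add: act_add)
  then show ?thesis by blast
qed

text \<open>By \<open>nonmeager_local\<close>, some point of the orbit lies in \<open>B\<close> and
  is moved into \<open>B\<close> by nonmeagerly many short elements.\<close>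

lemma limit_set_meets_orbit:
  assumes "x \<in> vaught act UNIV B"
  shows "\<exists>g. act g x \<in> limit_set"
proof -
  have "\<not> meager {g. act g x \<in> B}" using assms by (simp add: vaught_def)
  then obtain g where g: "act g x \<in> B" "\<not> meager {w. \<rho> w < \<epsilon> / 2 \<and> w + g \<in> {g. act g x \<in> B}}"
    using nonmeager_local[of "{g. act g x \<in> B}" "\<epsilon> / 2"] eps_pos by auto
  then have "act g x \<in> vaught act {w. \<rho> w < \<epsilon> / 2} B"
    by (simp add: vaught_def act_add)
  then obtain k where "act k (act g x) \<in> limit_set"
    using limit_set_meets_orbit_of_dense_point g(1) by blast
  then show ?thesis by (metis act_add)
qed

end

section \<open>From a complete left-invariant metric to a length\<close>

lemma cli_length_action:
  fixes act :: "'g::{topological_group_add, polish_space} \<Rightarrow> 'x::t2_space \<Rightarrow> 'x"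
  assumes "cli TYPE('g)" and "continuous_action act"
  obtains \<rho> where "length_action \<rho> act"
proof -
  obtain d :: "'g \<Rightarrow> 'g \<Rightarrow> real" where d: "Metric_space UNIV d"
    and top: "Metric_space.mtopology UNIV d = euclidean"
    and complete: "Metric_space.mcomplete UNIV d"
    and left: "\<And>g x y. d (g + x) (g + y) = d x y"
    using assms(1) unfolding cli_def by blast
  interpret d: Metric_space UNIV d by (rule d)
  have opn: "open {y. d x y < r}" for x r
    using d.openin_mball[of x r] unfolding top by (simp add: d.mball_def)
  have "length_action (d 0) act"
  proof
    show "d 0 0 = 0" by simp
    show minus: "d 0 (- g) = d 0 g" for g
      using left[of g 0 "- g"] by (simp add: d.commute)
    show "d 0 (g + h) \<le> d 0 g + d 0 h" for g h
      using d.triangle[of 0 g "g + h"] left[of g 0 h] by simp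
    show "continuous_on UNIV (d 0)"
      unfolding continuous_on_def
    proof (intro ballI tendstoI)
      fix x and e :: real assume "e > 0"
      then have "\<forall>\<^sub>F y in nhds x. d x y < e"
        using opn[of x e] unfolding eventually_nhds by (intro exI[of _ "{y. d x y < e}"]) simp
      then have "\<forall>\<^sub>F y in nhds x. dist (d 0 y) (d 0 x) < e"
      proof (rule eventually_mono)
        fix y assume "d x y < e"
        then show "dist (d 0 y) (d 0 x) < e"
          using d.triangle[of 0 x y] d.triangle[of 0 y x] d.commute[of x y]
          by (simp add: dist_real_def abs_less_iff)
      qed
      then show "\<forall>\<^sub>F y in at x. dist (d 0 y) (d 0 x) < e"
        unfolding eventually_at_filter by (rule eventually_mono) simp
    qed
    show "\<exists>r>0. {g. d 0 g < r} \<subseteq> U" if "open U" "0 \<in> U" for U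
      using that d.openin_mtopology[of U] unfolding top by (simp add: d.mball_def)
    show "convergent s"
      if s: "\<And>e. e > 0 \<Longrightarrow> \<exists>N. \<forall>m\<ge>N. \<forall>n\<ge>N. d 0 (s m - s n) < e" for s
    proof -
      \<comment> \<open>Inversion exchanges \<open>d\<close> with a right-invariant metric, which is complete as well.\<close>
      have "d (- s m) (- s n) = d 0 (s m - s n)" for m n
        using left[of "s m" "- s m" "- s n"] by simp
      then have "d.MCauchy (\<lambda>n. - s n)"
        unfolding d.MCauchy_def using s by simp
      then obtain l where "(\<lambda>n. - s n) \<longlonglongrightarrow> l"
        using complete unfolding d.mcomplete_def top by auto
      from tendsto_minus[OF this] show "convergent s"
        unfolding convergent_def by auto
    qed
  qed (rule assms(2))
  then show thesis by (rule that)
qed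

section \<open>Assembly of countably many lacunary sections\<close>

theorem proposition2p3:
  fixes act :: "'g::{topological_group_add, polish_space} \<Rightarrow> 'x::metric_space \<Rightarrow> 'x"
    and \<Delta> :: "nat \<Rightarrow> 'g set"
    and B :: "nat \<Rightarrow> 'x set"
  assumes "cli TYPE('g)"
    and "analytic_set (UNIV :: 'x set)"
    and "continuous_action act"
    and "open_nhds_basis_0 \<Delta>"
    and "\<forall>i. symmetric_set (\<Delta> i)"
    and "\<forall>n. B n \<in> sets borel"
    and "(\<Union>n. B n) = UNIV"
    and "\<forall>n. \<exists>i. \<forall>j. countable_borel_chromatic (B n) (orbit_graph act \<Delta> i j \<inter> (B n \<times> B n))"
  shows "sigma_lacunary act"
proof -
  obtain \<rho> where "length_action \<rho> act"
    using cli_length_action[OF assms(1,3)] .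
  then interpret length_action \<rho> act .
  \<comment> \<open>The chromatic hypothesis in terms of \<open>near\<close>: the radius
    \<open>r\<close> stands for \<open>\<Delta> i\<close>, and \<open>e\<close> for
    \<open>\<Delta> j\<close>.\<close>
  define coloring where "coloring n r e c \<longleftrightarrow> (\<forall>k. {x \<in> B n. c x = k} \<in> sets borel) \<and>
    (\<forall>x\<in>B n. \<forall>y\<in>B n. near r x y \<longrightarrow> c x = c y \<longrightarrow> near e x y)"
    for n r e and c :: "'x \<Rightarrow> nat"
  have "\<exists>r>0. \<forall>e>0. \<exists>c. coloring n r e c" for n
  proof -
    obtain i where i: "\<And>j. countable_borel_chromatic (B n) (orbit_graph act \<Delta> i j \<inter> (B n \<times> B n))"
      using assms(8) by blast
    obtain r where r: "r > 0" "{g. \<rho> g < r} \<subseteq> \<Delta> i"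
      using len_basis[of "\<Delta> i"] assms(4) unfolding open_nhds_basis_0_def by blast
    have "\<exists>c. coloring n r e c" if "e > 0" for e
    proof -
      have "open {g. \<rho> g < e} \<and> 0 \<in> {g. \<rho> g < e}"
        using open_len_ball that by (simp add: len_zero)
      then obtain j where j: "\<Delta> j \<subseteq> {g. \<rho> g < e}"
        using assms(4) unfolding open_nhds_basis_0_def by blast
      obtain c :: "'x \<Rightarrow> nat" where c: "c \<in> borel_measurable (restrict_space borel (B n))"
        and proper: "\<forall>(x, y)\<in>orbit_graph act \<Delta> i j \<inter> (B n \<times> B n). c x \<noteq> c y"
        using i[of j] unfolding countable_borel_chromatic_def by blast
      have "{x \<in> B n. c x = k} \<in> sets borel" for k
      proof -
        have "c -` {k} \<inter> space (restrict_space borel (B n)) \<in> sets (restrict_space borel (B n))"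
          by (rule measurable_sets[OF c]) simp
        moreover have "c -` {k} \<inter> space (restrict_space borel (B n)) = {x \<in> B n. c x = k}"
          by (auto simp: space_restrict_space)
        ultimately show ?thesis
          using assms(6) by (simp add: sets_restrict_space_iff)
      qed
      moreover have "near e x y" if "x \<in> B n" "y \<in> B n" "near r x y" "c x = c y" for x y
      proof -
        have "(x, y) \<in> orbit_rel act (\<Delta> i) UNIV"
          using that(3) r(2) unfolding near_def orbit_rel_def by auto
        \<comment> \<open>Equal colors exclude an edge, so a pair related by
          \<open>\<Delta> i\<close> must be related by \<open>\<Delta> j\<close>.\<close>
        moreover have "(x, y) \<notin> orbit_graph act \<Delta> i j"
          using proper that by auto
        ultimately have "(x, y) \<in> orbit_rel act (\<Delta> j) UNIV"
          unfolding orbit_graph_def by blast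
        then show ?thesis
          using j unfolding near_def orbit_rel_def by auto
      qed
      ultimately show ?thesis unfolding coloring_def by blast
    qed
    then show ?thesis using r(1) by blast
  qed
  then obtain r where r: "\<And>n. r n > 0" "\<And>n e. e > 0 \<Longrightarrow> \<exists>c. coloring n (r n) e c"
    by metis
  have "\<exists>c. coloring n (r n) (r n / 20 * (1/2)^p) c" for n p
    using r(1)[of n] by (intro r(2)) simp
  then obtain c where c: "\<And>n p. coloring n (r n) (r n / 20 * (1/2)^p) (c n p)"
    by metis
  \<comment> \<open>A piece is a color class of the coarsest coloring \<open>c n 0\<close>: there
    \<open>r n\<close>-near points are \<open>r n / 20\<close>-near, which yields
    \<open>near_B\<close>. \<open>prod_decode\<close> enumerates the pairs of set index and
    color.\<close>
  define D where "D m = {x \<in> B (fst (prod_decode m)). c (fst (prod_decode m)) 0 x = snd (prod_decode m)}" for m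
  have D: "colored_set \<rho> act (D m) (r (fst (prod_decode m))) (c (fst (prod_decode m)))" for m
  proof -
    obtain n k where nk: "prod_decode m = (n, k)" by fastforce
    have sets_D: "D m \<in> sets borel"
      using c[of n 0] unfolding coloring_def D_def nk by simp
    have D_B: "x \<in> B n" "c n 0 x = k" if "x \<in> D m" for x
      using that by (simp_all add: D_def nk)
    show ?thesis
      unfolding nk fst_conv
    proof (unfold_locales)
      show "D m \<in> sets borel" by (rule sets_D)
      show "0 < r n" by (rule r(1))
      show "near (r n / 4) x y" if "x \<in> D m" "y \<in> D m" "near (r n) x y" for x y
      proof -
        have "near (r n / 20 * (1/2)^0) x y"
          using c[of n 0] D_B[OF that(1)] D_B[OF that(2)] that(3) unfolding coloring_def by simp
        then show ?thesis by (rule near_mono) (use r(1)[of n] in simp)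
      qed
      show "{x \<in> D m. c n p x = j} \<in> sets borel" for p j
      proof -
        have "{x \<in> D m. c n p x = j} = D m \<inter> {x \<in> B n. c n p x = j}"
          using D_B by auto
        moreover have "{x \<in> B n. c n p x = j} \<in> sets borel"
          using c[of n p] unfolding coloring_def by blast
        ultimately show ?thesis
          using sets.Int[OF sets_D] by simp
      qed
      show "near (r n / 20 * (1/2)^p) x y"
        if "x \<in> D m" "y \<in> D m" "near (r n) x y" "c n p x = c n p y" for x y p
        using c[of n p] D_B that unfolding coloring_def by blast
    qed
  qed
  define Z where "Z m = colored_set.limit_set \<rho> act (D m) (r (fst (prod_decode m))) (c (fst (prod_decode m)))" for m
  define X where "X m = vaught act UNIV (D m)" for m
  have D_cover: "(\<Union>m. D m) = UNIV"
  proof -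
    have "x \<in> (\<Union>m. D m)" for x
    proof -
      obtain n where "x \<in> B n" using assms(7) by blast
      then have "x \<in> D (prod_encode (n, c n 0 x))" by (simp add: D_def)
      then show ?thesis by blast
    qed
    then show ?thesis by blast
  qed
  have invariant: "act g x \<in> X m" if "x \<in> X m" for g x m
    using vaught_UNIV_act that unfolding X_def by blast
  show ?thesis
    unfolding sigma_lacunary_def
  proof (rule exI[of _ X], rule exI[of _ "\<lambda>m. {g. \<rho> g < r (fst (prod_decode m)) / 2}"],
      rule exI[of _ "\<lambda>m. Z m \<inter> X m"], intro conjI allI)
    \<comment> \<open>The union of the transforms is the transform of the union of the
      \<open>D m\<close>, which is everything; so it contains every point as the group is nonmeager
      in itself.\<close>
    have "\<not> meager (UNIV :: 'g set)"
      using meager_open_imp_empty[of "UNIV :: 'g set"] by auto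
    then show "(\<Union>m. X m) = UNIV"
      unfolding X_def vaught_UN[symmetric] D_cover by (simp add: vaught_def)
    fix m
    interpret D: colored_set \<rho> act "D m" "r (fst (prod_decode m))" "c (fst (prod_decode m))"
      by (rule D)
    show X: "X m \<in> sets borel"
      unfolding X_def by (rule sets_vaught[OF D.sets_B open_UNIV])
    show "invariant_set (orbit_rel act UNIV UNIV) (X m)"
      using invariant unfolding invariant_set_def orbit_rel_def by auto
    show "open {g. \<rho> g < r (fst (prod_decode m)) / 2}" by (rule open_len_ball)
    show "0 \<in> {g. \<rho> g < r (fst (prod_decode m)) / 2}" using r(1) by (simp add: len_zero)
    show "Z m \<inter> X m \<in> sets borel"
      using D.sets_limit_set X unfolding Z_def by blast
    show "Z m \<inter> X m \<subseteq> X m" by blast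
    show "lacunary act {g. \<rho> g < r (fst (prod_decode m)) / 2} (Z m \<inter> X m)"
      using D.limit_set_lacunary unfolding Z_def lacunary_def orbit_rel_def near_def by auto
    show "complete_for (X m) (orbit_rel act UNIV (X m)) (Z m \<inter> X m)"
      unfolding complete_for_def
    proof
      fix C assume "C \<in> X m // orbit_rel act UNIV (X m)"
      then obtain x where x: "x \<in> X m" "C = orbit_rel act UNIV (X m) `` {x}"
        by (rule quotientE)
      obtain g where "act g x \<in> Z m"
        using D.limit_set_meets_orbit x(1) unfolding X_def Z_def by blast
      moreover have "act g x \<in> C" "act g x \<in> X m"
        using invariant x unfolding orbit_rel_def by auto
      ultimately show "Z m \<inter> X m \<inter> C \<noteq> {}" by blast
    qed
  qed
qed

end
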